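(* Let $n\ge 3$ and reals $s_1,s_2$. For any $a,b\in S_3$ with $a\succ_3 b$ there is a continuous function $p:[0,1]\to S_3$ with $p(0)=b$, $p(1)=a$, and $p(t_1)\succ_3 p(t_0)$ whenever $t_1\ge t_0$.
   Context: $S_3:=\{(x_1,\dots,x_n)\in\mathbb{R}^n : x_1\ge\cdots\ge x_n,\ \sum_{i=1}^n x_i=s_1,\ \sum_{i=1}^n x_i^2=s_2\}$ with the subspace topology from $\mathbb{R}^n$. For $a,b\in\mathbb{R}^n$, $a\succ_3 b$ means $\sum_{i=1}^n f(a_i)\ge\sum_{i=1}^n f(b_i)$ for every three times differentiable $f:\mathbb{R}\to\mathbb{R}$ with $f'''\ge 0$. *)

theory Defs
  imports "HOL-Analysis.Analysis"
begin

text \<open>Points of R^n are represented as functions nat => real; only the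
coordinates 0..n-1 (corresponding to x_1..x_n) are relevant.\<close>

definition S3 :: "nat \<Rightarrow> real \<Rightarrow> real \<Rightarrow> (nat \<Rightarrow> real) set" where
  "S3 n s1 s2 = {x. (\<forall>i j. i \<le> j \<longrightarrow> j < n \<longrightarrow> x j \<le> x i)
                  \<and> (\<Sum>i<n. x i) = s1 \<and> (\<Sum>i<n. (x i)^2) = s2}"

definition f3adm :: "(real \<Rightarrow> real) \<Rightarrow> bool" where
  "f3adm f \<longleftrightarrow> (\<exists>f1 f2 f3. (\<forall>x. (f has_real_derivative f1 x) (at x))
      \<and> (\<forall>x. (f1 has_real_derivative f2 x) (at x))
      \<and> (\<forall>x. (f2 has_real_derivative f3 x) (at x))
      \<and> (\<forall>x. f3 x \<ge> 0))"

definition succ3 :: "nat \<Rightarrow> (nat \<Rightarrow> real) \<Rightarrow> (nat \<Rightarrow> real) \<Rightarrow> bool" where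
  "succ3 n a b \<longleftrightarrow> (\<forall>f. f3adm f \<longrightarrow> (\<Sum>i<n. f (a i)) \<ge> (\<Sum>i<n. f (b i)))"

end

theory Submission
  imports Defs
begin

text \<open>
On \<open>S\<^sub>3\<close> the order \<open>\<succ>\<^sub>3\<close> is tested by the functions \<open>x \<mapsto> (t - x)\<^sub>+\<^sup>2\<close>. If \<open>a\<close> strictly dominates \<open>b\<close>,
the difference \<open>D\<close> of the two test sums is nonnegative and nonzero. On its leftmost positivity interval
\<open>(u, v)\<close> the point \<open>u\<close> is a coordinate of \<open>b\<close>, and matching first and second moments force at least two
further coordinates of \<open>b\<close> strictly inside. Moving these three coordinates slightly along the circle that
preserves their sum and their sum of squares pushes \<open>b\<close> up while staying below \<open>a\<close>. Hence the order is dense,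
with the sum of cubes as a strictly monotone continuous height. On a maximal chain between \<open>b\<close> and \<open>a\<close>,
which is compact because the order is closed, the height is injective and by density onto an interval;
its inverse is the path.
\<close>

section \<open>Quadratic interpolation and three-point moves\<close>

lemma rolle3:
  fixes g g1 g2 g3 :: "real \<Rightarrow> real"
  assumes d: "\<And>x. (g has_real_derivative g1 x) (at x)"
    "\<And>x. (g1 has_real_derivative g2 x) (at x)"
    "\<And>x. (g2 has_real_derivative g3 x) (at x)"
    and o: "p < q" "q < r" "r < s"
    and z: "g p = 0" "g q = 0" "g r = 0" "g s = 0"
  shows "\<exists>\<xi>. g3 \<xi> = 0"
proof -
  have R: "\<exists>z. x < z \<and> z < y \<and> f' z = 0"
    if "\<And>x. (f has_real_derivative f' x) (at x)" "x < y" "f x = f y" for f f' :: "real \<Rightarrow> real" and x y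
    using MVT2[of x y f f'] that by auto
  obtain a1 where a1: "p < a1" "a1 < q" "g1 a1 = 0" using R[OF d(1) o(1)] z by auto
  obtain a2 where a2: "q < a2" "a2 < r" "g1 a2 = 0" using R[OF d(1) o(2)] z by auto
  obtain a3 where a3: "r < a3" "a3 < s" "g1 a3 = 0" using R[OF d(1) o(3)] z by auto
  obtain c1 where c1: "a1 < c1" "c1 < a2" "g2 c1 = 0" using R[OF d(2), of a1 a2] a1 a2 by auto
  obtain c2 where c2: "a2 < c2" "c2 < a3" "g2 c2 = 0" using R[OF d(2), of a2 a3] a2 a3 by auto
  show ?thesis using R[OF d(3), of c1 c2] c1 c2 by auto
qed

text \<open>By the error formula, \<open>f s\<close> minus the interpolating quadratic is
  \<open>f''' \<xi> / 6\<close> times the nodal cubic \<open>(s - p) * (s - q) * (s - r)\<close>, so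
  it is nonpositive wherever the cubic is negative.\<close>

lemma quadratic_interpolation_sign:
  fixes f :: "real \<Rightarrow> real"
  assumes f: "f3adm f" and o: "p < q" "q < r"
  obtains A B C where "f p = A + B * p + C * p\<^sup>2" "f q = A + B * q + C * q\<^sup>2" "f r = A + B * r + C * r\<^sup>2"
    "\<And>s. (s - p) * (s - q) * (s - r) < 0 \<Longrightarrow> f s \<le> A + B * s + C * s\<^sup>2"
proof -
  obtain f1 f2 f3 where d: "\<And>x. (f has_real_derivative f1 x) (at x)"
    "\<And>x. (f1 has_real_derivative f2 x) (at x)"
    "\<And>x. (f2 has_real_derivative f3 x) (at x)" and pos: "\<And>x. f3 x \<ge> 0"
    using f unfolding f3adm_def by blast
  \<comment> \<open>\<open>c1\<close> and \<open>C\<close> are the first and second divided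
    differences; \<open>A\<close> and \<open>B\<close> come from expanding Newton's form in powers
    of \<open>s\<close>.\<close>
  define c1 where "c1 = (f q - f p) / (q - p)"
  define C where "C = ((f r - f p) / (r - p) - c1) / (r - q)"
  define A where "A = f p - c1 * p + C * p * q"
  define B where "B = c1 - C * (p + q)"
  define Q where "Q = (\<lambda>s. A + B * s + C * s\<^sup>2)"
  have newton: "Q s = f p + c1 * (s - p) + C * (s - p) * (s - q)" for s
    unfolding Q_def A_def B_def by (simp add: algebra_simps power2_eq_square)
  have Qp: "Q p = f p" by (simp add: newton)
  have Qq: "Q q = f q" using o by (simp add: newton c1_def)
  have "C * (r - q) = (f r - f p) / (r - p) - c1"
    using o by (simp add: C_def)
  then have "C * (r - q) * (r - p) = ((f r - f p) / (r - p)) * (r - p) - c1 * (r - p)"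
    by (simp only: left_diff_distrib)
  then have "C * (r - q) * (r - p) = f r - f p - c1 * (r - p)"
    using o by simp
  then have "C * (r - p) * (r - q) = f r - f p - c1 * (r - p)"
    by (simp add: mult_ac)
  then have Qr: "Q r = f r" by (simp add: newton)
  have "f s \<le> Q s" if neg: "(s - p) * (s - q) * (s - r) < 0" for s
  proof -
    \<comment> \<open>\<open>K\<close> is chosen to make \<open>g\<close> vanish at \<open>s\<close>
      too. With four zeros of \<open>g\<close>, Rolle yields a zero of \<open>g3\<close>, that is,
      \<open>K = f3 \<xi> / 6\<close>.\<close>
    define K where "K = (f s - Q s) / ((s - p) * (s - q) * (s - r))"
    define g where "g = (\<lambda>t. f t - Q t - K * ((t - p) * (t - q) * (t - r)))"
    define g1 where "g1 = (\<lambda>t. f1 t - (B + 2 * C * t) - K * ((t - q) * (t - r) + (t - p) * (t - r) + (t - p) * (t - q)))"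
    define g2 where "g2 = (\<lambda>t. f2 t - 2 * C - K * (6 * t - 2 * (p + q + r)))"
    define g3 where "g3 = (\<lambda>t. f3 t - K * 6)"
    have d1: "(g has_real_derivative g1 x) (at x)" for x
      unfolding g_def g1_def Q_def
      by (rule derivative_eq_intros d refl | simp add: algebra_simps)+
    have d2: "(g1 has_real_derivative g2 x) (at x)" for x
      unfolding g1_def g2_def
      by (rule derivative_eq_intros d refl | simp add: algebra_simps)+
    have d3: "(g2 has_real_derivative g3 x) (at x)" for x
      unfolding g2_def g3_def
      by (rule derivative_eq_intros d refl | simp)+
    have z: "g p = 0" "g q = 0" "g r = 0" using Qp Qq Qr by (auto simp: g_def)
    have nz: "(s - p) * (s - q) * (s - r) \<noteq> 0" using neg by linarith
    then have K: "K * ((s - p) * (s - q) * (s - r)) = f s - Q s"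
      unfolding K_def by (rule nonzero_eq_divide_eq[THEN iffD1]) (rule refl)
    then have zs: "g s = 0" by (simp add: g_def)
    have "s \<noteq> p" "s \<noteq> q" "s \<noteq> r" using neg by auto
    then consider "s < p" | "p < s" "s < q" | "q < s" "s < r" | "r < s" by linarith
    then have "\<exists>\<xi>. g3 \<xi> = 0"
      by cases (use rolle3[OF d1 d2 d3] o z zs in blast)+
    then obtain \<xi> where "f3 \<xi> = K * 6" by (auto simp: g3_def)
    then have "K \<ge> 0" using pos[of \<xi>] by simp
    have "f s - Q s = K * ((s - p) * (s - q) * (s - r))" by (rule K[symmetric])
    also have "\<dots> \<le> 0" using \<open>K \<ge> 0\<close> neg by (simp add: mult_nonneg_nonpos)
    finally show ?thesis by simp
  qed
  then show ?thesis using that[of A B C] Qp Qq Qr unfolding Q_def by auto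
qed

text \<open>Interpolate \<open>f\<close> at the three new points. The old points lie where the nodal
  cubic is negative (\<open>z\<close> left of all nodes, \<open>y\<close> and \<open>x\<close>
  between the upper two), so there \<open>f\<close> is at most the quadratic, and the quadratic has
  the same sum over both triples.\<close>

lemma triple_move_f3adm:
  fixes f :: "real \<Rightarrow> real"
  assumes f: "f3adm f" and o: "z < z'" "z' < y'" "y' < y" "y \<le> x" "x < x'"
    and s: "x' + y' + z' = x + y + z" "x'\<^sup>2 + y'\<^sup>2 + z'\<^sup>2 = x\<^sup>2 + y\<^sup>2 + z\<^sup>2"
  shows "f x + f y + f z \<le> f x' + f y' + f z'"
proof -
  have "y' < x'" using o by simp
  from quadratic_interpolation_sign[OF f o(2) this] obtain A B C where
    i: "f z' = A + B * z' + C * z'\<^sup>2" "f y' = A + B * y' + C * y'\<^sup>2" "f x' = A + B * x' + C * x'\<^sup>2"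
    and le: "\<And>s. (s - z') * (s - y') * (s - x') < 0 \<Longrightarrow> f s \<le> A + B * s + C * s\<^sup>2" by metis
  have "f x \<le> A + B * x + C * x\<^sup>2"
    by (rule le) (use o in \<open>simp add: mult_pos_neg\<close>)
  moreover have "f y \<le> A + B * y + C * y\<^sup>2"
    by (rule le) (use o in \<open>simp add: mult_pos_neg\<close>)
  moreover have "f z \<le> A + B * z + C * z\<^sup>2"
    by (rule le) (use o in \<open>simp add: mult_pos_neg mult_neg_neg\<close>)
  moreover have "B * (x' + y' + z') + C * (x'\<^sup>2 + y'\<^sup>2 + z'\<^sup>2) = B * (x + y + z) + C * (x\<^sup>2 + y\<^sup>2 + z\<^sup>2)"
    by (simp add: s)
  ultimately show ?thesis by (simp add: i algebra_simps)
qed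

section \<open>From admissible functions to truncated squares\<close>

text \<open>A smoothing of \<open>(x - t) * \<bar>x - t\<bar>\<close>, which is not twice
  differentiable at \<open>t\<close> and hence not admissible itself.\<close>

lemma f3adm_smoothed_square:
  assumes h: "h > 0"
  shows "f3adm (\<lambda>x. (x - t) * sqrt ((x - t)\<^sup>2 + h\<^sup>2))"
proof -
  define S where "S = (\<lambda>x. sqrt ((x - t)\<^sup>2 + h\<^sup>2))"
  have pos: "(x - t)\<^sup>2 + h\<^sup>2 > 0" for x using h by (simp add: add_nonneg_pos)
  have Sp: "S x > 0" for x using pos by (simp add: S_def)
  have dS: "(S has_real_derivative (x - t) / S x) (at x)" for x
  proof -
    have "((\<lambda>x. (x - t)\<^sup>2 + h\<^sup>2) has_real_derivative 2 * (x - t)) (at x)"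
      by (rule derivative_eq_intros refl | simp)+
    from DERIV_chain2[OF DERIV_real_sqrt[OF pos] this]
    have "(S has_real_derivative inverse (S x) / 2 * (2 * (x - t))) (at x)"
      unfolding S_def .
    moreover have "inverse c / 2 * (2 * d) = d / c" for c d :: real
      by (simp add: inverse_eq_divide)
    ultimately show ?thesis by metis
  qed
  \<comment> \<open>Writing the derivatives through the reciprocal \<open>R\<close> keeps them
    polynomial in \<open>x - t\<close>, \<open>S\<close> and \<open>R\<close>; the third one becomes
    \<open>R\<close> times a perfect square.\<close>
  define R where "R = (\<lambda>x. inverse (S x))"
  have dR: "(R has_real_derivative - (x - t) * (R x)^3) (at x)" for x
  proof -
    have "S x \<noteq> 0" using Sp[of x] by simp
    from DERIV_inverse_fun[OF dS this]
    show ?thesis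
      unfolding R_def by (rule DERIV_cong) (simp add: divide_inverse power3_eq_cube algebra_simps)
  qed
  have dSR: "(S has_real_derivative (x - t) * R x) (at x)" for x
    using dS[of x] by (simp add: R_def divide_inverse)
  have d1: "((\<lambda>x. (x - t) * S x) has_real_derivative S x + (x - t)\<^sup>2 * R x) (at x)" for x
    by (rule derivative_eq_intros dSR refl | simp add: power2_eq_square)+
  have d2: "((\<lambda>x. S x + (x - t)\<^sup>2 * R x) has_real_derivative 3 * (x - t) * R x - (x - t)^3 * (R x)^3) (at x)" for x
    by (rule derivative_eq_intros dSR dR refl | simp)+ (simp add: algebra_simps eval_nat_numeral)
  have d3: "((\<lambda>x. 3 * (x - t) * R x - (x - t)^3 * (R x)^3) has_real_derivative
      3 * R x * (1 - (x - t)\<^sup>2 * (R x)\<^sup>2)\<^sup>2) (at x)" for x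
    by (rule derivative_eq_intros dR refl | simp)+ (simp add: algebra_simps eval_nat_numeral)
  have d4: "3 * R x * (1 - (x - t)\<^sup>2 * (R x)\<^sup>2)\<^sup>2 \<ge> 0" for x
    using Sp[of x] by (simp add: R_def)
  have S: "(\<lambda>x. (x - t) * sqrt ((x - t)\<^sup>2 + h\<^sup>2)) = (\<lambda>x. (x - t) * S x)" by (simp add: S_def)
  show ?thesis
    unfolding f3adm_def S
    by (rule exI[of _ "\<lambda>x. S x + (x - t)\<^sup>2 * R x"],
        rule exI[of _ "\<lambda>x. 3 * (x - t) * R x - (x - t)^3 * (R x)^3"],
        rule exI[of _ "\<lambda>x. 3 * R x * (1 - (x - t)\<^sup>2 * (R x)\<^sup>2)\<^sup>2"])
      (simp only: d1 d2 d3 d4 simp_thms)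
qed

text \<open>The arguments are in increasing order: \<open>le3 n x y\<close> corresponds to \<open>succ3 n y x\<close>. The sums of
\<open>(t - x)\<^sub>+\<^sup>2\<close> reverse direction because \<open>x \<mapsto> (t - x)\<^sub>+\<^sup>2\<close> differs from \<open>- (x - t)\<^sub>+\<^sup>2\<close> by a quadratic.\<close>

definition le3 :: "nat \<Rightarrow> (nat \<Rightarrow> real) \<Rightarrow> (nat \<Rightarrow> real) \<Rightarrow> bool" where
  "le3 n x y \<longleftrightarrow> (\<forall>t. (\<Sum>i<n. (max 0 (t - y i))\<^sup>2) \<le> (\<Sum>i<n. (max 0 (t - x i))\<^sup>2))"

text \<open>Killing the irrelevant coordinates makes the set compact in the product topology.\<close>

definition S30 :: "nat \<Rightarrow> real \<Rightarrow> real \<Rightarrow> (nat \<Rightarrow> real) set" where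
  "S30 n s1 s2 = {x \<in> S3 n s1 s2. \<forall>i\<ge>n. x i = 0}"

lemma S3_sum_quadratic:
  assumes "x \<in> S3 n s1 s2"
  shows "(\<Sum>i<n. A + B * x i + C * (x i)\<^sup>2) = real n * A + B * s1 + C * s2"
  using assms by (simp add: S3_def sum.distrib flip: sum_distrib_left)

text \<open>Letting the smoothing parameter tend to 0 gives the inequality for
  \<open>(x - t) * \<bar>x - t\<bar>\<close>. Half of it differs from the negative of the truncated
  square by a quadratic, whose sum is constant on \<open>S3\<close>.\<close>

lemma le3_if_succ3:
  assumes a: "a \<in> S3 n s1 s2" and b: "b \<in> S3 n s1 s2" and ab: "succ3 n a b"
  shows "le3 n b a"
  unfolding le3_def
proof
  fix t
  let ?g = "\<lambda>x h. (x - t) * sqrt ((x - t)\<^sup>2 + h\<^sup>2)"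
  have lim: "((\<lambda>h. \<Sum>i<n. ?g (x i) h) \<longlongrightarrow> (\<Sum>i<n. ?g (x i) 0)) (at_right 0)" for x :: "nat \<Rightarrow> real"
    by (intro tendsto_intros)
  have "(\<Sum>i<n. ?g (b i) 0) \<le> (\<Sum>i<n. ?g (a i) 0)"
  proof (rule tendsto_le[OF _ lim lim])
    show "\<forall>\<^sub>F h in at_right 0. (\<Sum>i<n. ?g (b i) h) \<le> (\<Sum>i<n. ?g (a i) h)"
      using eventually_at_right_less[of "0::real"]
    proof eventually_elim
      case (elim h)
      show ?case using ab f3adm_smoothed_square[OF elim, of t] unfolding succ3_def by blast
    qed
  qed simp
  moreover have "(max 0 (t - x))\<^sup>2 = (t\<^sup>2 / 2 + (- t) * x + 1 / 2 * x\<^sup>2) - ?g x 0 / 2" for x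
  proof (cases "x \<le> t")
    case True
    then have m: "max 0 (t - x) = t - x" and "?g x 0 = (x - t) * (t - x)" by auto
    then have g: "?g x 0 = - (t - x)\<^sup>2" by (simp only: power2_eq_square) (simp add: algebra_simps)
    show ?thesis unfolding m g by (simp add: power2_eq_square field_simps)
  next
    case False
    then have m: "max 0 (t - x) = 0" and "?g x 0 = (x - t) * (x - t)" by auto
    then have g: "?g x 0 = (t - x)\<^sup>2" by (simp only: power2_eq_square) (simp add: algebra_simps)
    show ?thesis unfolding m g by (simp add: power2_eq_square field_simps)
  qed
  then have "(\<Sum>i<n. (max 0 (t - x i))\<^sup>2) = (real n * (t\<^sup>2 / 2) + (- t) * s1 + 1 / 2 * s2) - (\<Sum>i<n. ?g (x i) 0) / 2"
    if "x \<in> S3 n s1 s2" for x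
    by (simp only: sum_subtractf S3_sum_quadratic[OF that] sum_divide_distrib)
  ultimately show "(\<Sum>i<n. (max 0 (t - a i))\<^sup>2) \<le> (\<Sum>i<n. (max 0 (t - b i))\<^sup>2)"
    using a b by simp
qed

section \<open>Rearrangement and a residue inequality\<close>

text \<open>Brings a point whose coordinates were moved back into decreasing order without affecting
  any of the sums in play.\<close>

lemma ex_antimono_rearrangement:
  fixes x :: "nat \<Rightarrow> real"
  shows "\<exists>y. (\<forall>i j. i \<le> j \<longrightarrow> j < n \<longrightarrow> y j \<le> y i) \<and> (\<forall>i\<ge>n. y i = 0)
    \<and> (\<forall>f :: real \<Rightarrow> real. (\<Sum>i<n. f (y i)) = (\<Sum>i<n. f (x i)))"
proof -
  define l where "l = rev (sort (map x [0..<n]))"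
  define y where "y = (\<lambda>i. if i < n then l ! i else 0)"
  have len: "length l = n" by (simp add: l_def)
  have "sorted (rev l)" by (simp add: l_def)
  then have 1: "y j \<le> y i" if "i \<le> j" "j < n" for i j
    using that len by (auto simp: y_def intro: sorted_rev_nth_mono)
  have 3: "(\<Sum>i<n. f (y i)) = (\<Sum>i<n. f (x i))" for f :: "real \<Rightarrow> real"
  proof -
    have "(\<Sum>i<n. f (y i)) = (\<Sum>i<n. map f l ! i)" by (rule sum.cong) (auto simp: y_def len)
    also have "\<dots> = sum_list (map f l)" by (simp add: sum_list_sum_nth len atLeast0LessThan)
    also have "\<dots> = sum_mset (mset (map f l))" by (simp only: sum_mset_sum_list)
    also have "mset (map f l) = mset (map f (map x [0..<n]))" by (simp only: mset_map l_def mset_rev mset_sort)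
    also have "sum_mset \<dots> = sum_list (map f (map x [0..<n]))" by (simp only: sum_mset_sum_list)
    also have "\<dots> = (\<Sum>i<n. f (x i))" by (simp add: sum_list_sum_nth atLeast0LessThan)
    finally show ?thesis .
  qed
  show ?thesis by (rule exI[of _ y]) (simp add: 1 3, simp add: y_def)
qed

text \<open>The function sending \<open>s\<close> to \<open>y * (w - y)\<close>, where \<open>y\<close> is the residue of \<open>s\<close> modulo \<open>w\<close>, is
subadditive, strictly so when the residues overflow \<open>w\<close>.\<close>

lemma sum_residue_parabola:
  fixes \<alpha> :: "'i \<Rightarrow> real" and w y :: real and r :: nat
  assumes fin: "finite I" and \<alpha>: "\<And>i. i \<in> I \<Longrightarrow> 0 \<le> \<alpha> i \<and> \<alpha> i < w"
    and y: "0 \<le> y" "y < w" and r: "r \<ge> 1" and s: "(\<Sum>i\<in>I. \<alpha> i) = real r * w + y"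
  shows "y * (w - y) < (\<Sum>i\<in>I. \<alpha> i * (w - \<alpha> i))"
proof -
  \<comment> \<open>The induction carries the division with remainder of the partial sum by
    \<open>w\<close>; \<open>q \<ge> 1\<close> records that an overflow has occurred, and each
    overflow makes the bound strict.\<close>
  have "\<exists>q::nat. \<exists>z. 0 \<le> z \<and> z < w \<and> (\<Sum>i\<in>I. \<alpha> i) = real q * w + z
      \<and> z * (w - z) \<le> (\<Sum>i\<in>I. \<alpha> i * (w - \<alpha> i)) \<and> (q \<ge> 1 \<longrightarrow> z * (w - z) < (\<Sum>i\<in>I. \<alpha> i * (w - \<alpha> i)))"
    using fin \<alpha>
  proof (induction I)
    case empty
    then show ?case using y by (intro exI[of _ 0]) auto
  next
    case (insert j I)
    then obtain q z where IH: "0 \<le> z" "z < w" "(\<Sum>i\<in>I. \<alpha> i) = real q * w + z"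
      "z * (w - z) \<le> (\<Sum>i\<in>I. \<alpha> i * (w - \<alpha> i))"
      "q \<ge> 1 \<longrightarrow> z * (w - z) < (\<Sum>i\<in>I. \<alpha> i * (w - \<alpha> i))" by auto
    have \<alpha>j: "0 \<le> \<alpha> j" "\<alpha> j < w" using insert.prems by auto
    show ?case
    proof (cases "z + \<alpha> j < w")
      case True
      have "(z + \<alpha> j) * (w - (z + \<alpha> j)) = z * (w - z) + \<alpha> j * (w - \<alpha> j) - 2 * (z * \<alpha> j)"
        by (simp add: algebra_simps)
      moreover have "z * \<alpha> j \<ge> 0" using IH \<alpha>j by simp
      ultimately have "(z + \<alpha> j) * (w - (z + \<alpha> j)) \<le> z * (w - z) + \<alpha> j * (w - \<alpha> j)" by linarith
      then show ?thesis
        using True IH \<alpha>j insert.hyps by (intro exI[of _ q] exI[of _ "z + \<alpha> j"]) auto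
    next
      case False
      have "(z + \<alpha> j - w) * (w - (z + \<alpha> j - w)) = z * (w - z) + \<alpha> j * (w - \<alpha> j) - 2 * ((w - z) * (w - \<alpha> j))"
        by (simp add: algebra_simps)
      moreover have "(w - z) * (w - \<alpha> j) > 0" using IH \<alpha>j by simp
      ultimately have "(z + \<alpha> j - w) * (w - (z + \<alpha> j - w)) < z * (w - z) + \<alpha> j * (w - \<alpha> j)" by linarith
      then show ?thesis
        using False IH \<alpha>j insert.hyps
        by (intro exI[of _ "Suc q"] exI[of _ "z + \<alpha> j - w"]) (auto simp: algebra_simps)
    qed
  qed
  then obtain q z where q: "0 \<le> z" "z < w" "(\<Sum>i\<in>I. \<alpha> i) = real q * w + z"
    "q \<ge> 1 \<longrightarrow> z * (w - z) < (\<Sum>i\<in>I. \<alpha> i * (w - \<alpha> i))" by blast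
  have w: "w > 0" using y by simp
  have "(real q - real r) * w = y - z" using q s by (simp add: algebra_simps)
  moreover have "\<bar>y - z\<bar> < 1 * w" using q y by auto
  ultimately have "\<bar>real q - real r\<bar> * w < 1 * w" using w by (metis abs_mult abs_of_pos)
  then have "\<bar>real q - real r\<bar> < 1" using w by (simp only: mult_less_cancel_right)
  then have "q = r" by linarith
  then show ?thesis using q s r by simp
qed

section \<open>The leftmost bump of the difference of test sums\<close>

text \<open>The squared positive part is convex, so it lies above its tangents, and its derivative
  is 2-Lipschitz, so it exceeds them by at most \<open>h\<^sup>2\<close>.\<close>

lemma pos_part_square_expansion:
  fixes z h :: real
  shows "(max 0 (z + h))\<^sup>2 \<le> (max 0 z)\<^sup>2 + 2 * h * max 0 z + h\<^sup>2"
    and "(max 0 z)\<^sup>2 + 2 * h * max 0 z \<le> (max 0 (z + h))\<^sup>2"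
proof -
  show "(max 0 (z + h))\<^sup>2 \<le> (max 0 z)\<^sup>2 + 2 * h * max 0 z + h\<^sup>2"
  proof (cases "z \<ge> 0")
    case True
    then have "(max 0 (z + h))\<^sup>2 \<le> (z + h)\<^sup>2" by (auto simp: max_def)
    with True show ?thesis by (simp add: power2_sum mult_ac)
  next
    case False
    then have "(max 0 (z + h))\<^sup>2 \<le> \<bar>h\<bar>\<^sup>2" by (intro power_mono) auto
    with False show ?thesis by simp
  qed
  have "0 \<le> (max 0 (z + h) - max 0 z)\<^sup>2 + 2 * (max 0 z * (max 0 (z + h) - (max 0 z + h)))
      \<or> max 0 z = 0"
    by (auto simp: max_def)
  moreover have "max 0 z = 0 \<Longrightarrow> (max 0 z)\<^sup>2 + 2 * h * max 0 z \<le> (max 0 (z + h))\<^sup>2" by simp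
  ultimately show "(max 0 z)\<^sup>2 + 2 * h * max 0 z \<le> (max 0 (z + h))\<^sup>2"
    by (auto simp: power2_eq_square algebra_simps)
qed

text \<open>Let \<open>v\<close> be the first zero of \<open>D\<close> after the bump that starts at
  \<open>b k\<close>. There \<open>D\<close> also has zero derivative, so the truncated distances of
  \<open>a\<close> and of \<open>b\<close> to \<open>v\<close> share their first two moments. Fewer
  than two coordinates of \<open>b\<close> strictly inside the bump would contradict
  \<open>sum_residue_parabola\<close>.\<close>

lemma leftmost_bump:
  fixes a b :: "nat \<Rightarrow> real" and k :: nat
  defines "D \<equiv> \<lambda>t. \<Sum>i\<le>k. (max 0 (t - b i))\<^sup>2 - (max 0 (t - a i))\<^sup>2"
  assumes a: "\<And>i. i \<le> k \<Longrightarrow> a k \<le> a i" and b: "\<And>i. i \<le> k \<Longrightarrow> b k \<le> b i"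
    and ne: "a k \<noteq> b k" and nonneg: "\<And>t. D t \<ge> 0" and zero: "\<And>t. t \<ge> T \<Longrightarrow> D t = 0"
  obtains i j v \<theta> where "i \<le> k" "j \<le> k" "i \<noteq> j" "b k < b j" "b j \<le> b i" "b i < v"
    "b k < \<theta>" "\<And>t. b k \<le> t \<Longrightarrow> t \<le> \<theta> \<Longrightarrow> (t - b k)\<^sup>2 \<le> D t"
    "\<And>t. b k < t \<Longrightarrow> t < v \<Longrightarrow> 0 < D t"
proof -
  have lt: "b k < a k"
  proof (rule ccontr)
    assume "\<not> b k < a k"
    then have "a k < b k" using ne by simp
    have "(b k - a k)\<^sup>2 \<le> (max 0 (b k - a k))\<^sup>2" using \<open>a k < b k\<close> by simp
    also have "\<dots> \<le> (\<Sum>i\<le>k. (max 0 (b k - a i))\<^sup>2)"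
      by (rule member_le_sum[of k "{..k}" "\<lambda>i. (max 0 (b k - a i))\<^sup>2"]) auto
    also have "(\<Sum>i\<le>k. (max 0 (b k - b i))\<^sup>2) = 0" by (rule sum.neutral) (use b in auto)
    then have "(\<Sum>i\<le>k. (max 0 (b k - a i))\<^sup>2) = - D (b k)" by (simp add: D_def sum_subtractf)
    also have "\<dots> \<le> 0" using nonneg by simp
    finally show False using \<open>a k < b k\<close> by simp
  qed
  \<comment> \<open>Up to \<open>a k\<close> all terms of \<open>a\<close> are zero. This quadratic
    bound provides \<open>\<theta>\<close>; mere positivity of \<open>D\<close> would not absorb the
    cost \<open>(t - b k)\<^sup>2\<close> of moving \<open>b k\<close> at points \<open>t\<close>
    just to its right.\<close>
  have low: "(t - b k)\<^sup>2 \<le> D t" if "b k \<le> t" "t \<le> a k" for t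
  proof -
    have "(t - b k)\<^sup>2 = (max 0 (t - b k))\<^sup>2" using that by simp
    also have "\<dots> \<le> (\<Sum>i\<le>k. (max 0 (t - b i))\<^sup>2)"
      by (rule member_le_sum[of k "{..k}" "\<lambda>i. (max 0 (t - b i))\<^sup>2"]) auto
    also have "\<dots> = D t"
      unfolding D_def
    proof (rule sum.cong)
      fix i assume "i \<in> {..k}"
      then have "t \<le> a i" using a[of i] that by simp
      then show "(max 0 (t - b i))\<^sup>2 = (max 0 (t - b i))\<^sup>2 - (max 0 (t - a i))\<^sup>2" by simp
    qed simp
    finally show ?thesis .
  qed
  have cont: "continuous_on UNIV D" unfolding D_def by (intro continuous_intros)
  \<comment> \<open>The zeros are sought from \<open>a k\<close> on, because \<open>D\<close> also
    vanishes at \<open>b k\<close>, where the bump begins.\<close>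
  define Z where "Z = {t. a k \<le> t \<and> D t = 0}"
  define v where "v = Inf Z"
  have "closed Z" unfolding Z_def
    by (intro closed_Collect_conj closed_Collect_le closed_Collect_eq continuous_intros cont)
  moreover have "max T (a k) \<in> Z" using zero by (simp add: Z_def)
  moreover have bdd: "bdd_below Z" unfolding Z_def by (rule bdd_belowI[of _ "a k"]) simp
  ultimately have "v \<in> Z" unfolding v_def using closed_contains_Inf[of Z] by blast
  then have v: "a k \<le> v" "D v = 0" by (auto simp: Z_def)
  have pos: "0 < D t" if "b k < t" "t < v" for t
  proof (cases "t \<le> a k")
    case True
    have "0 < (t - b k)\<^sup>2" using that by simp
    also have "\<dots> \<le> D t" using that True by (intro low) auto
    finally show ?thesis .
  next
    case False
    have "t \<notin> Z" using that(2) cInf_lower[OF _ bdd] unfolding v_def by force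
    then show ?thesis using False nonneg[of t] by (auto simp: Z_def less_le)
  qed
  define w where "w = v - b k"
  have w: "w > 0" using v lt by (simp add: w_def)
  define \<alpha> where "\<alpha> = (\<lambda>i. max 0 (v - a i))"
  define \<beta> where "\<beta> = (\<lambda>i. max 0 (v - b i))"
  have sq: "(\<Sum>i\<le>k. (\<beta> i)\<^sup>2) = (\<Sum>i\<le>k. (\<alpha> i)\<^sup>2)"
    using v(2) by (simp add: D_def \<alpha>_def \<beta>_def sum_subtractf)
  \<comment> \<open>The nonnegative \<open>D\<close> attains its minimum at \<open>v\<close>, so its derivative \<open>2 * G\<close> vanishes there.\<close>
  define G where "G = (\<Sum>i\<le>k. \<beta> i - \<alpha> i)"
  have step: "0 \<le> 2 * h * G + real (Suc k) * h\<^sup>2" for h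
  proof -
    have "0 \<le> D (v + h) - D v" using nonneg v by simp
    also have "\<dots> \<le> (\<Sum>i\<le>k. 2 * h * (\<beta> i - \<alpha> i) + h\<^sup>2)"
      unfolding D_def sum_subtractf[symmetric]
    proof (rule sum_mono)
      fix i
      show "(max 0 (v + h - b i))\<^sup>2 - (max 0 (v + h - a i))\<^sup>2 - ((max 0 (v - b i))\<^sup>2 - (max 0 (v - a i))\<^sup>2)
          \<le> 2 * h * (\<beta> i - \<alpha> i) + h\<^sup>2"
        using pos_part_square_expansion(1)[of "v - b i" h] pos_part_square_expansion(2)[of "v - a i" h]
        by (simp add: \<alpha>_def \<beta>_def algebra_simps)
    qed
    also have "\<dots> = 2 * h * G + real (Suc k) * h\<^sup>2"
      by (simp add: G_def sum.distrib sum_distrib_left)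
    finally show ?thesis .
  qed
  have "G = 0"
  proof -
    define N where "N = real (Suc k)"
    have N: "N > 0" by (simp add: N_def)
    \<comment> \<open>\<open>h = - G / N\<close> minimises the quadratic in \<open>step\<close>; its
      minimum \<open>- (G\<^sup>2 / N)\<close> can be nonnegative only for
      \<open>G = 0\<close>.\<close>
    have "0 \<le> 2 * (- G / N) * G + N * (- G / N)\<^sup>2" using step[of "- G / N"] by (simp add: N_def)
    also have "\<dots> = - (G\<^sup>2 / N)" using N by (simp add: field_simps power2_eq_square)
    finally have "G\<^sup>2 / N \<le> 0" by simp
    then show ?thesis using N by (simp add: divide_le_0_iff)
  qed
  then have lin: "(\<Sum>i\<le>k. \<beta> i) = (\<Sum>i\<le>k. \<alpha> i)" by (simp add: G_def sum_subtractf)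
  \<comment> \<open>With at most one coordinate of \<open>b\<close> inside \<open>(b k, v)\<close>, the numbers \<open>\<beta> i\<close> consist of copies of \<open>w\<close>
    and a single residue; \<open>\<alpha>\<close> has the same first two moments but stays below \<open>w\<close>.\<close>
  have "\<exists>i j. i \<le> k \<and> j \<le> k \<and> i \<noteq> j \<and> b k < b i \<and> b i < v \<and> b k < b j \<and> b j < v"
  proof (rule ccontr)
    assume no: "\<not> ?thesis"
    define r where "r = card {i. i \<le> k \<and> b i = b k}"
    have "{i. i \<le> k \<and> b i = b k} \<noteq> {}" by auto
    then have r: "r \<ge> 1" unfolding r_def by (simp add: card_gt_0_iff Suc_le_eq)
    \<comment> \<open>\<open>m\<close> is the only index with \<open>b m\<close> inside the bump,
      and \<open>y = v - b m\<close>. If there is none, \<open>y = 0\<close> and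
      \<open>m = k\<close> is a dummy.\<close>
    obtain m y where m: "m \<le> k" and y: "0 \<le> y" "y < w"
      and \<beta>: "\<And>i. i \<le> k \<Longrightarrow> \<beta> i = (if b i = b k then w else 0) + (if i = m then y else 0)"
      and h: "\<And>i. i \<le> k \<Longrightarrow> \<beta> i * (w - \<beta> i) = (if i = m then y * (w - y) else 0)"
    proof (cases "\<exists>m\<le>k. b k < b m \<and> b m < v")
      case True
      then obtain m where m: "m \<le> k" "b k < b m" "b m < v" by blast
      have *: "b i = b k \<or> i = m \<or> v \<le> b i" if "i \<le> k" for i
        using no m b[of i] that by force
      show ?thesis
        by (rule that[of m "v - b m"])
          (use m * w in \<open>fastforce simp: w_def \<beta>_def max_def\<close>)+
    next
      case False
      then have *: "b i = b k \<or> v \<le> b i" if "i \<le> k" for i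
        using b[of i] that by force
      show ?thesis
        by (rule that[of k 0]) (use * w in \<open>fastforce simp: w_def \<beta>_def max_def\<close>)+
    qed
    have "(\<Sum>i\<le>k. \<beta> i) = (\<Sum>i\<le>k. if b i = b k then w else 0) + (\<Sum>i\<le>k. if i = m then y else 0)"
      unfolding sum.distrib[symmetric] by (rule sum.cong) (simp_all add: \<beta>)
    also have "(\<Sum>i\<le>k. if b i = b k then w else 0) = (\<Sum>i\<in>{i. i \<le> k \<and> b i = b k}. w)"
      by (rule sum.mono_neutral_cong_right) auto
    finally have "(\<Sum>i\<le>k. \<alpha> i) = real r * w + y"
      using m by (simp add: lin r_def)
    then have "y * (w - y) < (\<Sum>i\<le>k. \<alpha> i * (w - \<alpha> i))"
      by (intro sum_residue_parabola[of _ _ _ _ r]) (use a lt w y r in \<open>force simp: \<alpha>_def w_def\<close>)+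
    also have "\<dots> = (\<Sum>i\<le>k. \<beta> i * (w - \<beta> i))"
      using lin sq by (simp add: right_diff_distrib sum_subtractf power2_eq_square flip: sum_distrib_right)
    also have "\<dots> = (\<Sum>i\<le>k. if i = m then y * (w - y) else 0)" by (rule sum.cong) (simp_all add: h)
    also have "\<dots> = y * (w - y)" using m by simp
    finally show False by simp
  qed
  then obtain i j where "i \<le> k" "j \<le> k" "i \<noteq> j" "b k < b i" "b i < v" "b k < b j" "b j < v" by blast
  then obtain i j where "i \<le> k" "j \<le> k" "i \<noteq> j" "b k < b j" "b j \<le> b i" "b i < v"
    by (metis linear)
  from that[OF this lt low pos] show ?thesis .
qed

section \<open>Moving three coordinates while staying below the target\<close>

lemma triple_move_ex:
  fixes x y z :: real
  assumes o: "z < y" "y \<le> x"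
  obtains X Y where "(X \<longlongrightarrow> x) (at_right 0)" "(Y \<longlongrightarrow> y) (at_right 0)"
    "\<forall>\<^sub>F \<epsilon> in at_right 0. x < X \<epsilon> \<and> Y \<epsilon> < y \<and> z + \<epsilon> < Y \<epsilon>
      \<and> X \<epsilon> + Y \<epsilon> + (z + \<epsilon>) = x + y + z \<and> (X \<epsilon>)\<^sup>2 + (Y \<epsilon>)\<^sup>2 + (z + \<epsilon>)\<^sup>2 = x\<^sup>2 + y\<^sup>2 + z\<^sup>2
      \<and> x^3 + y^3 + z^3 < (X \<epsilon>)^3 + (Y \<epsilon>)^3 + (z + \<epsilon>)^3"
proof -
  \<comment> \<open>Once \<open>z\<close> moves to \<open>z + \<epsilon>\<close>, the other two are the roots with mean \<open>m\<close> and half-distance \<open>sqrt W\<close>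
    that the sum and the sum of squares prescribe.\<close>
  define m where "m = (\<lambda>\<epsilon>::real. (x + y - \<epsilon>) / 2)"
  define W where "W = (\<lambda>\<epsilon>::real. ((x - y) / 2)\<^sup>2 + \<epsilon> * (x + y - 2 * z) / 2 - 3 / 4 * \<epsilon>\<^sup>2)"
  define X where "X = (\<lambda>\<epsilon>. m \<epsilon> + sqrt (W \<epsilon>))"
  define Y where "Y = (\<lambda>\<epsilon>. m \<epsilon> - sqrt (W \<epsilon>))"
  have mlim: "(m \<longlongrightarrow> (x + y) / 2) (at_right 0)" unfolding m_def by (auto intro!: tendsto_eq_intros)
  have Wlim: "(W \<longlongrightarrow> ((x - y) / 2)\<^sup>2) (at_right 0)" unfolding W_def by (auto intro!: tendsto_eq_intros)
  have sq: "sqrt (((x - y) / 2)\<^sup>2) = (x - y) / 2" using o by simp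
  have slim: "((\<lambda>\<epsilon>. sqrt (W \<epsilon>)) \<longlongrightarrow> (x - y) / 2) (at_right 0)" using tendsto_real_sqrt[OF Wlim] sq by simp
  have X: "(X \<longlongrightarrow> x) (at_right 0)"
    using tendsto_add[OF mlim slim] unfolding X_def by (simp add: field_simps)
  have Y: "(Y \<longlongrightarrow> y) (at_right 0)"
    using tendsto_diff[OF mlim slim] unfolding Y_def by (simp add: field_simps)
  have "((\<lambda>\<epsilon>. Y \<epsilon> - \<epsilon>) \<longlongrightarrow> y) (at_right 0)" using Y by (auto intro!: tendsto_eq_intros)
  from order_tendstoD(1)[OF this o(1)]
  have e1: "\<forall>\<^sub>F \<epsilon> in at_right 0. z < Y \<epsilon> - \<epsilon>" .
  have e2: "\<forall>\<^sub>F \<epsilon> in at_right 0. \<epsilon> < y - z"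
    using o by (intro order_tendstoD(2)[OF tendsto_ident_at]) auto
  show ?thesis
  proof (rule that[OF X Y])
    show "\<forall>\<^sub>F \<epsilon> in at_right 0. x < X \<epsilon> \<and> Y \<epsilon> < y \<and> z + \<epsilon> < Y \<epsilon>
      \<and> X \<epsilon> + Y \<epsilon> + (z + \<epsilon>) = x + y + z \<and> (X \<epsilon>)\<^sup>2 + (Y \<epsilon>)\<^sup>2 + (z + \<epsilon>)\<^sup>2 = x\<^sup>2 + y\<^sup>2 + z\<^sup>2
      \<and> x^3 + y^3 + z^3 < (X \<epsilon>)^3 + (Y \<epsilon>)^3 + (z + \<epsilon>)^3"
      using e1 e2 eventually_at_right_less[of "0::real"]
    proof eventually_elim
      case (elim \<epsilon>)
      define s where "s = sqrt (W \<epsilon>)"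
      \<comment> \<open>The resulting lower bound on \<open>s\<close> is exactly
        \<open>x < X \<epsilon>\<close>; since \<open>\<epsilon>\<close> is positive it also yields
        \<open>Y \<epsilon> < y\<close>.\<close>
      have "W \<epsilon> - ((x - y) / 2 + \<epsilon> / 2)\<^sup>2 = \<epsilon> * (y - z - \<epsilon>)"
        by (simp add: W_def power2_eq_square field_simps)
      also have "\<dots> > 0" using elim by simp
      finally have gt: "((x - y) / 2 + \<epsilon> / 2)\<^sup>2 < W \<epsilon>" by simp
      then have s: "(x - y) / 2 + \<epsilon> / 2 < s" unfolding s_def by (rule real_less_rsqrt)
      have "W \<epsilon> \<ge> 0" using gt by (meson less_imp_le order_le_less_trans zero_le_power2)
      then have s2: "s * s = W \<epsilon>" unfolding s_def by simp
      have XY: "X \<epsilon> = m \<epsilon> + s" "Y \<epsilon> = m \<epsilon> - s" by (simp_all add: X_def Y_def s_def)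
      have "(X \<epsilon>)\<^sup>2 + (Y \<epsilon>)\<^sup>2 = 2 * (m \<epsilon>)\<^sup>2 + 2 * (s * s)"
        unfolding XY by (simp add: power2_eq_square algebra_simps)
      then have q: "(X \<epsilon>)\<^sup>2 + (Y \<epsilon>)\<^sup>2 + (z + \<epsilon>)\<^sup>2 = x\<^sup>2 + y\<^sup>2 + z\<^sup>2"
        unfolding s2 by (simp add: W_def m_def power2_eq_square field_simps)
      \<comment> \<open>With sum and sum of squares fixed, the sum of cubes changes by three times
        the change of the product. Evaluating the monic cubic with roots \<open>x\<close>,
        \<open>y\<close>, \<open>z\<close> at \<open>z + \<epsilon>\<close> gives that change as
        \<open>\<epsilon> * (x - z - \<epsilon>) * (y - z - \<epsilon>)\<close>.\<close>
      have "(X \<epsilon>)^3 + (Y \<epsilon>)^3 = 2 * (m \<epsilon>)^3 + 6 * m \<epsilon> * (s * s)"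
        unfolding XY by (simp add: power3_eq_cube algebra_simps)
      then have "(X \<epsilon>)^3 + (Y \<epsilon>)^3 + (z + \<epsilon>)^3 = x^3 + y^3 + z^3 + 3 * (\<epsilon> * (x - z - \<epsilon>) * (y - z - \<epsilon>))"
        unfolding s2 by (simp add: W_def m_def power3_eq_cube power2_eq_square field_simps)
      moreover have "\<epsilon> * (x - z - \<epsilon>) * (y - z - \<epsilon>) > 0" using elim o by simp
      ultimately have c: "x^3 + y^3 + z^3 < (X \<epsilon>)^3 + (Y \<epsilon>)^3 + (z + \<epsilon>)^3" by linarith
      have "X \<epsilon> + Y \<epsilon> + (z + \<epsilon>) = x + y + z" unfolding XY by (simp add: m_def)
      moreover have "x < X \<epsilon>" unfolding XY using s by (simp add: m_def field_simps)
      moreover have "Y \<epsilon> < y" unfolding XY using s elim by (simp add: m_def field_simps)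
      ultimately show ?case using q c elim by auto
    qed
  qed
qed

lemma f3adm_cube: "f3adm (\<lambda>x. x^3)"
  unfolding f3adm_def
proof (rule exI[of _ "\<lambda>x::real. 3 * x\<^sup>2"], rule exI[of _ "\<lambda>x::real. 6 * x"], rule exI[of _ "\<lambda>x::real. 6"], intro conjI allI)
  show "((\<lambda>x. x^3) has_real_derivative 3 * x\<^sup>2) (at x)" for x :: real
    by (rule derivative_eq_intros refl | simp)+
  show "((\<lambda>x. 3 * x\<^sup>2) has_real_derivative 6 * x) (at x)" for x :: real
    by (rule derivative_eq_intros refl | simp)+
  show "((\<lambda>x. 6 * x) has_real_derivative 6) (at x)" for x :: real
    by (rule derivative_eq_intros refl | simp)+
qed simp

lemma sum_fun_upd3:
  fixes g :: "real \<Rightarrow> real" and n :: nat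
  assumes "i < n" "j < n" "k < n" "i \<noteq> j" "i \<noteq> k" "j \<noteq> k"
  shows "(\<Sum>l<n. g ((b(i := x, j := y, k := z)) l)) - (\<Sum>l<n. g (b l)) = g x + g y + g z - g (b i) - g (b j) - g (b k)"
proof -
  have split: "(\<Sum>l<n. g (c l)) = (\<Sum>l\<in>{..<n} - {i, j, k}. g (c l)) + (g (c i) + g (c j) + g (c k))" for c :: "nat \<Rightarrow> real"
  proof -
    have "(\<Sum>l<n. g (c l)) = (\<Sum>l\<in>{..<n} - {i, j, k}. g (c l)) + (\<Sum>l\<in>{i, j, k}. g (c l))"
      by (rule sum.subset_diff) (use assms in auto)
    then show ?thesis using assms by (simp add: add.assoc)
  qed
  have "(\<Sum>l\<in>{..<n} - {i, j, k}. g ((b(i := x, j := y, k := z)) l)) = (\<Sum>l\<in>{..<n} - {i, j, k}. g (b l))"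
    by (rule sum.cong) auto
  then show ?thesis unfolding split using assms by simp
qed

text \<open>Factor the difference of squares: the positive part is 1-Lipschitz, and both positive
  parts are at most \<open>M\<close>. The bound is uniform in \<open>t\<close> and small for small
  moves.\<close>

lemma pos_part_square_diff_le:
  fixes t p q z M :: real
  assumes "z \<le> p" "z \<le> q" "t \<le> z + M" "M \<ge> 0"
  shows "(max 0 (t - p))\<^sup>2 - (max 0 (t - q))\<^sup>2 \<le> \<bar>q - p\<bar> * (2 * M)"
proof -
  have "(max 0 (t - p))\<^sup>2 - (max 0 (t - q))\<^sup>2
      = (max 0 (t - p) - max 0 (t - q)) * (max 0 (t - p) + max 0 (t - q))"
    by (simp add: power2_eq_square algebra_simps)
  also have "\<dots> \<le> \<bar>q - p\<bar> * (max 0 (t - p) + max 0 (t - q))"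
    by (rule mult_right_mono) (auto simp: max_def)
  also have "\<dots> \<le> \<bar>q - p\<bar> * (2 * M)"
    by (rule mult_left_mono) (use assms in auto)
  finally show ?thesis .
qed

text \<open>The cost of the move is 0 for \<open>t \<le> z\<close> and, by the equal moments, for
  \<open>t\<close> beyond \<open>x'\<close>. Just right of \<open>z\<close> it is at most
  \<open>(t - z)\<^sup>2\<close>, which \<open>low\<close> covers. On the remaining compact stretch
  \<open>D\<close> has a positive minimum, which exceeds the cost of a small enough move.\<close>

lemma triple_move_below_bump:
  fixes x y z v \<theta> \<eta> :: real and D :: "real \<Rightarrow> real"
  assumes o: "z < y" "y \<le> x" "x < v" and \<theta>: "z < \<theta>" and \<eta>: "\<eta> > 0"
    and cont: "continuous_on UNIV D" and nonneg: "\<And>t. D t \<ge> 0"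
    and low: "\<And>t. z \<le> t \<Longrightarrow> t \<le> \<theta> \<Longrightarrow> (t - z)\<^sup>2 \<le> D t"
    and pos: "\<And>t. z < t \<Longrightarrow> t < v \<Longrightarrow> 0 < D t"
  obtains x' y' z' where "x < x'" "y' < y" "z' < y'" "z < z'"
    "x' + y' + z' = x + y + z" "x'\<^sup>2 + y'\<^sup>2 + z'\<^sup>2 = x\<^sup>2 + y\<^sup>2 + z\<^sup>2"
    "x^3 + y^3 + z^3 < x'^3 + y'^3 + z'^3" "x'^3 + y'^3 + z'^3 < x^3 + y^3 + z^3 + \<eta>"
    "\<forall>t. (max 0 (t - x))\<^sup>2 + (max 0 (t - y))\<^sup>2 + (max 0 (t - z))\<^sup>2
      - ((max 0 (t - x'))\<^sup>2 + (max 0 (t - y'))\<^sup>2 + (max 0 (t - z'))\<^sup>2) \<le> D t"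
proof -
  \<comment> \<open>Keeping the largest moved point below \<open>\<xi>\<close> leaves
    \<open>{\<tau>..\<xi>}\<close> compactly inside the bump; up to \<open>\<tau>\<close> only
    \<open>z\<close> among the old points contributes to the cost.\<close>
  define \<xi> where "\<xi> = (x + v) / 2"
  define \<tau> where "\<tau> = min \<theta> y"
  have \<xi>: "x < \<xi>" "\<xi> < v" using o by (auto simp: \<xi>_def)
  have \<tau>: "z < \<tau>" "\<tau> \<le> y" "\<tau> \<le> \<theta>" using o \<theta> by (auto simp: \<tau>_def)
  have "\<exists>s\<in>{\<tau>..\<xi>}. \<forall>t\<in>{\<tau>..\<xi>}. D s \<le> D t"
    using \<tau> \<xi> o by (intro continuous_attains_inf continuous_on_subset[OF cont]) auto
  then obtain s where s: "s \<in> {\<tau>..\<xi>}" "\<And>t. t \<in> {\<tau>..\<xi>} \<Longrightarrow> D s \<le> D t" by blast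
  have \<mu>: "D s > 0" using s \<tau> \<xi> by (intro pos) auto
  obtain X Y where X: "(X \<longlongrightarrow> x) (at_right 0)" and Y: "(Y \<longlongrightarrow> y) (at_right 0)"
    and ev: "\<forall>\<^sub>F \<epsilon> in at_right 0. x < X \<epsilon> \<and> Y \<epsilon> < y \<and> z + \<epsilon> < Y \<epsilon>
      \<and> X \<epsilon> + Y \<epsilon> + (z + \<epsilon>) = x + y + z \<and> (X \<epsilon>)\<^sup>2 + (Y \<epsilon>)\<^sup>2 + (z + \<epsilon>)\<^sup>2 = x\<^sup>2 + y\<^sup>2 + z\<^sup>2
      \<and> x^3 + y^3 + z^3 < (X \<epsilon>)^3 + (Y \<epsilon>)^3 + (z + \<epsilon>)^3"
    by (rule triple_move_ex[OF o(1,2)])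
  define M where "M = \<xi> - z"
  have "((\<lambda>\<epsilon>. \<bar>X \<epsilon> - x\<bar> * (2 * M) + \<bar>Y \<epsilon> - y\<bar> * (2 * M) + \<bar>z + \<epsilon> - z\<bar> * (2 * M))
      \<longlongrightarrow> \<bar>x - x\<bar> * (2 * M) + \<bar>y - y\<bar> * (2 * M) + \<bar>z + 0 - z\<bar> * (2 * M)) (at_right 0)"
    by (intro tendsto_intros X Y)
  then have e1: "\<forall>\<^sub>F \<epsilon> in at_right 0. \<bar>X \<epsilon> - x\<bar> * (2 * M) + \<bar>Y \<epsilon> - y\<bar> * (2 * M) + \<bar>z + \<epsilon> - z\<bar> * (2 * M) < D s"
    by (rule order_tendstoD(2)) (use \<mu> in simp)
  have "((\<lambda>\<epsilon>. (X \<epsilon>)^3 + (Y \<epsilon>)^3 + (z + \<epsilon>)^3) \<longlongrightarrow> x^3 + y^3 + (z + 0)^3) (at_right 0)"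
    by (intro tendsto_intros X Y)
  then have e2: "\<forall>\<^sub>F \<epsilon> in at_right 0. (X \<epsilon>)^3 + (Y \<epsilon>)^3 + (z + \<epsilon>)^3 < x^3 + y^3 + z^3 + \<eta>"
    by (rule order_tendstoD(2)) (use \<eta> in simp)
  have "\<forall>\<^sub>F \<epsilon> in at_right 0. X \<epsilon> < \<xi>" by (rule order_tendstoD(2)[OF X \<xi>(1)])
  with ev e1 e2 eventually_at_right_less[of "0::real"]
  have "\<forall>\<^sub>F \<epsilon> in at_right 0. (x < X \<epsilon> \<and> Y \<epsilon> < y \<and> z + \<epsilon> < Y \<epsilon>
      \<and> X \<epsilon> + Y \<epsilon> + (z + \<epsilon>) = x + y + z \<and> (X \<epsilon>)\<^sup>2 + (Y \<epsilon>)\<^sup>2 + (z + \<epsilon>)\<^sup>2 = x\<^sup>2 + y\<^sup>2 + z\<^sup>2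
      \<and> x^3 + y^3 + z^3 < (X \<epsilon>)^3 + (Y \<epsilon>)^3 + (z + \<epsilon>)^3) \<and> 0 < \<epsilon> \<and> X \<epsilon> < \<xi>
      \<and> \<bar>X \<epsilon> - x\<bar> * (2 * M) + \<bar>Y \<epsilon> - y\<bar> * (2 * M) + \<bar>z + \<epsilon> - z\<bar> * (2 * M) < D s
      \<and> (X \<epsilon>)^3 + (Y \<epsilon>)^3 + (z + \<epsilon>)^3 < x^3 + y^3 + z^3 + \<eta>"
    by eventually_elim blast
  from eventually_happens'[OF _ this] obtain \<epsilon> where
    *: "x < X \<epsilon>" "Y \<epsilon> < y" "z + \<epsilon> < Y \<epsilon>" "X \<epsilon> + Y \<epsilon> + (z + \<epsilon>) = x + y + z"
      "(X \<epsilon>)\<^sup>2 + (Y \<epsilon>)\<^sup>2 + (z + \<epsilon>)\<^sup>2 = x\<^sup>2 + y\<^sup>2 + z\<^sup>2"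
      "x^3 + y^3 + z^3 < (X \<epsilon>)^3 + (Y \<epsilon>)^3 + (z + \<epsilon>)^3" "0 < \<epsilon>" "X \<epsilon> < \<xi>"
      "\<bar>X \<epsilon> - x\<bar> * (2 * M) + \<bar>Y \<epsilon> - y\<bar> * (2 * M) + \<bar>z + \<epsilon> - z\<bar> * (2 * M) < D s"
      "(X \<epsilon>)^3 + (Y \<epsilon>)^3 + (z + \<epsilon>)^3 < x^3 + y^3 + z^3 + \<eta>"
    by auto
  have main: "(max 0 (t - x))\<^sup>2 + (max 0 (t - y))\<^sup>2 + (max 0 (t - z))\<^sup>2
      - ((max 0 (t - X \<epsilon>))\<^sup>2 + (max 0 (t - Y \<epsilon>))\<^sup>2 + (max 0 (t - (z + \<epsilon>)))\<^sup>2) \<le> D t" (is "?L \<le> _") for t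
  proof -
    consider "t \<le> z" | "z < t" "t \<le> \<tau>" | "\<tau> < t" "t \<le> X \<epsilon>" | "X \<epsilon> < t" by linarith
    then show ?thesis
    proof cases
      case 1
      then have "?L = 0" using o * by (simp add: max_def)
      then show ?thesis using nonneg[of t] by simp
    next
      case 2
      then have "max 0 (t - x) = 0" "max 0 (t - y) = 0" "max 0 (t - z) = t - z" using \<tau> o by auto
      then have "?L = (t - z)\<^sup>2 - ((max 0 (t - X \<epsilon>))\<^sup>2 + (max 0 (t - Y \<epsilon>))\<^sup>2 + (max 0 (t - (z + \<epsilon>)))\<^sup>2)"
        by simp
      also have "\<dots> \<le> (t - z)\<^sup>2" by (simp only: diff_le_eq le_add_same_cancel1 sum_power2_ge_zero add_nonneg_nonneg zero_le_power2)
      also have "\<dots> \<le> D t" using 2 \<tau> by (intro low) auto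
      finally show ?thesis .
    next
      case 3
      have "M \<ge> 0" "t \<le> z + M" using 3 * \<xi> o by (auto simp: M_def)
      note bound = pos_part_square_diff_le[OF _ _ this(2,1)]
      have "?L \<le> \<bar>X \<epsilon> - x\<bar> * (2 * M) + \<bar>Y \<epsilon> - y\<bar> * (2 * M) + \<bar>z + \<epsilon> - z\<bar> * (2 * M)"
        using bound[of x "X \<epsilon>"] bound[of y "Y \<epsilon>"] bound[of z "z + \<epsilon>"] o * by simp
      also have "\<dots> \<le> D s" using * by simp
      also have "\<dots> \<le> D t" using 3 * by (intro s(2)) auto
      finally show ?thesis .
    next
      case 4
      have "?L = (x\<^sup>2 + y\<^sup>2 + z\<^sup>2) - ((X \<epsilon>)\<^sup>2 + (Y \<epsilon>)\<^sup>2 + (z + \<epsilon>)\<^sup>2)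
          - 2 * t * ((x + y + z) - (X \<epsilon> + Y \<epsilon> + (z + \<epsilon>)))"
      proof -
        have "max 0 (t - x) = t - x" "max 0 (t - y) = t - y" "max 0 (t - z) = t - z"
          "max 0 (t - X \<epsilon>) = t - X \<epsilon>" "max 0 (t - Y \<epsilon>) = t - Y \<epsilon>" "max 0 (t - (z + \<epsilon>)) = t - (z + \<epsilon>)"
          using 4 * o by auto
        then show ?thesis by (simp only:) (simp add: power2_eq_square algebra_simps)
      qed
      also have "\<dots> = 0" unfolding *(4,5) by simp
      finally show ?thesis using nonneg[of t] by simp
    qed
  qed
  show ?thesis
  proof (rule that[OF *(1,2,3) _ *(4,5,6,10)])
    show "z < z + \<epsilon>" using * by simp
    show "\<forall>t. (max 0 (t - x))\<^sup>2 + (max 0 (t - y))\<^sup>2 + (max 0 (t - z))\<^sup>2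
      - ((max 0 (t - X \<epsilon>))\<^sup>2 + (max 0 (t - Y \<epsilon>))\<^sup>2 + (max 0 (t - (z + \<epsilon>)))\<^sup>2) \<le> D t"
      using main by blast
  qed
qed

text \<open>Beyond the last index \<open>k\<close> where \<open>a\<close> and \<open>b\<close>
  differ, their terms cancel in \<open>D\<close>, so the leftmost bump starts at \<open>b k\<close>
  and supplies the triple to move. The bound \<open>\<eta>\<close> lets the rise in height be kept
  below any prescribed gap.\<close>

lemma local_move:
  assumes a: "a \<in> S30 n s1 s2" and b: "b \<in> S30 n s1 s2" and le: "le3 n b a" and ne: "a \<noteq> b" and \<eta>: "\<eta> > 0"
  obtains c where "c \<in> S30 n s1 s2" "succ3 n c b" "le3 n c a"
    "(\<Sum>i<n. (b i)^3) < (\<Sum>i<n. (c i)^3)" "(\<Sum>i<n. (c i)^3) < (\<Sum>i<n. (b i)^3) + \<eta>"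
proof -
  have as: "\<And>i j. i \<le> j \<Longrightarrow> j < n \<Longrightarrow> a j \<le> a i" and bs: "\<And>i j. i \<le> j \<Longrightarrow> j < n \<Longrightarrow> b j \<le> b i"
    and a0: "\<And>i. n \<le> i \<Longrightarrow> a i = 0" and b0: "\<And>i. n \<le> i \<Longrightarrow> b i = 0"
    and a3: "a \<in> S3 n s1 s2" and b3: "b \<in> S3 n s1 s2"
    using a b by (auto simp: S30_def S3_def)
  define N where "N = {i. a i \<noteq> b i}"
  have sub: "N \<subseteq> {..<n}" using a0 b0 by (force simp: N_def not_le[symmetric])
  have fin: "finite N" using sub finite_subset by blast
  define k where "k = Max N"
  have "N \<noteq> {}" using ne by (auto simp: N_def)
  then have "k \<in> N" unfolding k_def using fin by (rule Max_in[rotated])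
  then have k: "k < n" "a k \<noteq> b k" using sub by (auto simp: N_def)
  have above: "a i = b i" if "k < i" for i
    using Max_ge[OF fin, of i] that unfolding k_def[symmetric] by (auto simp: N_def)
  define D where "D = (\<lambda>t. \<Sum>i\<le>k. (max 0 (t - b i))\<^sup>2 - (max 0 (t - a i))\<^sup>2)"
  have D: "D t = (\<Sum>i<n. (max 0 (t - b i))\<^sup>2) - (\<Sum>i<n. (max 0 (t - a i))\<^sup>2)" for t
    unfolding D_def sum_subtractf[symmetric]
    by (rule sum.mono_neutral_left) (use k above in auto)
  have nonneg: "D t \<ge> 0" for t using le by (simp add: D le3_def)
  \<comment> \<open>Coordinate 0 is the largest, so from here on no square is truncated and each sum
    depends only on the two moments.\<close>
  have zero: "D t = 0" if t: "max (a 0) (b 0) \<le> t" for t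
  proof -
    have "(\<Sum>i<n. (max 0 (t - x i))\<^sup>2) = real n * t\<^sup>2 + (- 2 * t) * s1 + 1 * s2"
      if x: "x \<in> S3 n s1 s2" and "x 0 \<le> t" for x
    proof -
      have "x i \<le> t" if "i < n" for i using x that \<open>x 0 \<le> t\<close> by (force simp: S3_def)
      then have "(\<Sum>i<n. (max 0 (t - x i))\<^sup>2) = (\<Sum>i<n. t\<^sup>2 + (- 2 * t) * x i + 1 * (x i)\<^sup>2)"
        by (intro sum.cong) (auto simp: power2_eq_square algebra_simps)
      then show ?thesis by (simp only: S3_sum_quadratic[OF x])
    qed
    then show ?thesis using a3 b3 t by (simp add: D)
  qed
  obtain i j v \<theta> where ij: "i \<le> k" "j \<le> k" "i \<noteq> j" "b k < b j" "b j \<le> b i" "b i < v"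
    and \<theta>: "b k < \<theta>" "\<And>t. b k \<le> t \<Longrightarrow> t \<le> \<theta> \<Longrightarrow> (t - b k)\<^sup>2 \<le> D t"
    and pos: "\<And>t. b k < t \<Longrightarrow> t < v \<Longrightarrow> 0 < D t"
    unfolding D_def
    by (rule leftmost_bump[where T = "max (a 0) (b 0)", OF _ _ k(2) nonneg[unfolded D_def] zero[unfolded D_def]])
      (use as bs k(1) in auto)
  have cont: "continuous_on UNIV D" unfolding D_def by (intro continuous_intros)
  obtain x' y' z' where o: "b i < x'" "y' < b j" "z' < y'" "b k < z'"
    and s: "x' + y' + z' = b i + b j + b k" "x'\<^sup>2 + y'\<^sup>2 + z'\<^sup>2 = (b i)\<^sup>2 + (b j)\<^sup>2 + (b k)\<^sup>2"
    and cube: "(b i)^3 + (b j)^3 + (b k)^3 < x'^3 + y'^3 + z'^3"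
      "x'^3 + y'^3 + z'^3 < (b i)^3 + (b j)^3 + (b k)^3 + \<eta>"
    and Dle: "\<forall>t. (max 0 (t - b i))\<^sup>2 + (max 0 (t - b j))\<^sup>2 + (max 0 (t - b k))\<^sup>2
      - ((max 0 (t - x'))\<^sup>2 + (max 0 (t - y'))\<^sup>2 + (max 0 (t - z'))\<^sup>2) \<le> D t"
    by (rule triple_move_below_bump[OF ij(4,5,6) \<theta>(1) \<eta> cont nonneg \<theta>(2) pos])
  \<comment> \<open>The moved coordinates may pass others that stayed in place, hence the sorted
    copy \<open>c\<close> of \<open>b'\<close>.\<close>
  define b' where "b' = b(i := x', j := y', k := z')"
  obtain c where cs: "\<forall>i j. i \<le> j \<longrightarrow> j < n \<longrightarrow> c j \<le> c i" and c0: "\<forall>i\<ge>n. c i = 0"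
    and csum: "\<forall>f :: real \<Rightarrow> real. (\<Sum>l<n. f (c l)) = (\<Sum>l<n. f (b' l))"
    using ex_antimono_rearrangement[of n b'] by blast
  have diff: "(\<Sum>l<n. f (c l)) = (\<Sum>l<n. f (b l)) + (f x' + f y' + f z' - f (b i) - f (b j) - f (b k))" for f :: "real \<Rightarrow> real"
  proof -
    have "i < n" "j < n" "i \<noteq> k" "j \<noteq> k" using ij k by auto
    from sum_fun_upd3[OF this(1,2) k(1) ij(3) this(3,4), of f b x' y' z', folded b'_def]
    show ?thesis using spec[OF csum, of f] by linarith
  qed
  show ?thesis
  proof (rule that)
    have "(\<Sum>l<n. c l) = s1" using diff[of "\<lambda>x. x"] b3 s by (simp add: S3_def)
    moreover have "(\<Sum>l<n. (c l)\<^sup>2) = s2" using diff[of "\<lambda>x. x\<^sup>2"] b3 s by (simp add: S3_def)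
    ultimately show "c \<in> S30 n s1 s2" using cs c0 by (auto simp: S30_def S3_def)
    show "succ3 n c b"
      unfolding succ3_def
    proof (intro allI impI)
      fix f assume "f3adm f"
      from triple_move_f3adm[OF this o(4,3,2) ij(5) o(1) s] diff[of f]
      show "(\<Sum>l<n. f (b l)) \<le> (\<Sum>l<n. f (c l))" by simp
    qed
    show "le3 n c a"
      unfolding le3_def
    proof
      fix t
      show "(\<Sum>l<n. (max 0 (t - a l))\<^sup>2) \<le> (\<Sum>l<n. (max 0 (t - c l))\<^sup>2)"
        using diff[of "\<lambda>x. (max 0 (t - x))\<^sup>2"] spec[OF Dle, of t] by (simp add: D)
    qed
    show "(\<Sum>i<n. (b i)^3) < (\<Sum>i<n. (c i)^3)" "(\<Sum>i<n. (c i)^3) < (\<Sum>i<n. (b i)^3) + \<eta>"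
      using diff[of "\<lambda>x. x^3"] cube by simp_all
  qed
qed

section \<open>Order properties, closedness and compactness\<close>

lemma le3_refl: "le3 n x x" by (simp add: le3_def)

lemma le3_trans: "le3 n x y \<Longrightarrow> le3 n y z \<Longrightarrow> le3 n x z"
  unfolding le3_def by (meson order_trans)

lemma succ3_trans: "succ3 n x y \<Longrightarrow> succ3 n y z \<Longrightarrow> succ3 n x z"
  unfolding succ3_def by (meson order_trans)

lemma S30_imp_S3: "x \<in> S30 n s1 s2 \<Longrightarrow> x \<in> S3 n s1 s2" by (simp add: S30_def)

lemma closed_le3_upper: "closed {c. le3 n b c}" and closed_le3_lower: "closed {c. le3 n c a}"
  unfolding le3_def
  by (intro closed_Collect_all closed_Collect_le continuous_intros continuous_on_product_coordinates)+

lemma closed_succ3: "closed {c. succ3 n c b}"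
  unfolding succ3_def
proof (rule closed_Collect_all)
  fix f
  show "closed {c. f3adm f \<longrightarrow> (\<Sum>i<n. f (b i)) \<le> (\<Sum>i<n. f (c i))}"
  proof (cases "f3adm f")
    case True
    then have "continuous_on UNIV f"
      unfolding f3adm_def by (meson DERIV_isCont continuous_at_imp_continuous_on)
    then have "continuous_on UNIV (\<lambda>c :: nat \<Rightarrow> real. f (c i))" for i
      by (rule continuous_on_compose2) auto
    then show ?thesis using True
      by (intro closed_Collect_imp open_Collect_const closed_Collect_le continuous_intros) auto
  qed simp
qed

lemma compact_S30: "compact (S30 n s1 s2)"
proof -
  \<comment> \<open>Since \<open>r\<^sup>2 \<ge> s2\<close>, this \<open>r\<close> bounds every
    coordinate and avoids square roots of \<open>s2\<close>.\<close>
  define r where "r = 1 + \<bar>s2\<bar>"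
  have r2: "r\<^sup>2 = 1 + s2\<^sup>2 + 2 * \<bar>s2\<bar>" by (simp add: r_def power2_sum)
  define S where "S = (\<lambda>i. if i < n then {- r..r} else {0::real})"
  have "compactin (product_topology (\<lambda>i. euclidean) UNIV) (PiE UNIV S)"
    by (simp add: compactin_PiE S_def)
  then have "compact (PiE UNIV S)"
    by (simp add: euclidean_product_topology)
  moreover have "closed (S30 n s1 s2)"
    unfolding S30_def S3_def mem_Collect_eq
    by (intro closed_Collect_conj closed_Collect_all closed_Collect_imp open_Collect_const
        closed_Collect_le closed_Collect_eq continuous_intros continuous_on_product_coordinates)
  moreover have "S30 n s1 s2 \<subseteq> PiE UNIV S"
  proof
    fix x assume x: "x \<in> S30 n s1 s2"
    have "x i \<in> S i" for i
    proof (cases "i < n")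
      case True
      have "(x i)\<^sup>2 \<le> (\<Sum>i<n. (x i)\<^sup>2)"
        by (rule member_le_sum[of i "{..<n}" "\<lambda>i. (x i)\<^sup>2"]) (use True in auto)
      also have "\<dots> = s2" using x by (simp add: S30_def S3_def)
      also have "s2 \<le> r\<^sup>2" 
        using abs_ge_self[of s2] abs_ge_zero[of s2] zero_le_power2[of s2]
        unfolding r2 by linarith
      finally have "\<bar>x i\<bar> \<le> \<bar>r\<bar>" by (simp only: abs_le_square_iff)
      then show ?thesis using True by (auto simp: S_def r_def)
    next
      case False
      then show ?thesis using x by (simp add: S_def S30_def)
    qed
    then show "x \<in> PiE UNIV S" by auto
  qed
  ultimately show ?thesis by (metis compact_Int_closed inf.absorb2)
qed

lemma continuous_sum_cubes: "continuous_on A (\<lambda>x :: nat \<Rightarrow> real. \<Sum>i<n. (x i)^3)"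
  by (intro continuous_intros continuous_on_subset[OF continuous_on_product_coordinates]) auto

section \<open>Equivalence of the two orders, strict height and density\<close>

lemma succ3_if_le3:
  assumes a: "a \<in> S30 n s1 s2" and b: "b \<in> S30 n s1 s2" and le: "le3 n b a"
  shows "succ3 n a b"
proof -
  \<comment> \<open>A highest point that is above \<open>b\<close> for \<open>succ3\<close> and below \<open>a\<close> for \<open>le3\<close> can only be \<open>a\<close>.\<close>
  define Q where "Q = S30 n s1 s2 \<inter> {c. le3 n c a} \<inter> {c. succ3 n c b}"
  have "compact Q" unfolding Q_def
    by (intro compact_Int_closed compact_S30 closed_le3_lower closed_succ3)
  moreover have "b \<in> Q" using b le by (simp add: Q_def succ3_def)
  ultimately have "\<exists>c\<in>Q. \<forall>d\<in>Q. (\<Sum>i<n. (d i)^3) \<le> (\<Sum>i<n. (c i)^3)"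
    by (intro continuous_attains_sup continuous_sum_cubes) auto
  then obtain c where c: "c \<in> Q" and max: "\<forall>d\<in>Q. (\<Sum>i<n. (d i)^3) \<le> (\<Sum>i<n. (c i)^3)"
    by (rule bexE)
  have "c = a"
  proof (rule ccontr)
    assume "c \<noteq> a"
    then obtain d where "d \<in> S30 n s1 s2" "succ3 n d c" "le3 n d a" "(\<Sum>i<n. (c i)^3) < (\<Sum>i<n. (d i)^3)"
      using local_move[OF a _ _ _ zero_less_one, of c] c by (auto simp: Q_def)
    moreover from this have "d \<in> Q" using c succ3_trans by (auto simp: Q_def)
    ultimately show False using max by fastforce
  qed
  then show ?thesis using c by (simp add: Q_def)
qed

text \<open>A local move already raises the height strictly, and from the moved point up to
  \<open>a\<close> it cannot fall, the cube being admissible.\<close>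

lemma le3_imp_sum_cubes_less:
  assumes a: "a \<in> S30 n s1 s2" and b: "b \<in> S30 n s1 s2" and le: "le3 n b a" and ne: "a \<noteq> b"
  shows "(\<Sum>i<n. (b i)^3) < (\<Sum>i<n. (a i)^3)"
proof -
  obtain c where c: "c \<in> S30 n s1 s2" "le3 n c a" "(\<Sum>i<n. (b i)^3) < (\<Sum>i<n. (c i)^3)"
    by (rule local_move[OF a b le ne zero_less_one])
  from succ3_if_le3[OF a c(1,2)] have "(\<Sum>i<n. (c i)^3) \<le> (\<Sum>i<n. (a i)^3)"
    using f3adm_cube unfolding succ3_def by blast
  then show ?thesis using c by simp
qed

text \<open>Taking the whole height gap as \<open>\<eta>\<close> keeps the moved point strictly
  lower than \<open>a\<close>.\<close>

lemma le3_dense: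
  assumes a: "a \<in> S30 n s1 s2" and b: "b \<in> S30 n s1 s2" and le: "le3 n b a" and ne: "a \<noteq> b"
  obtains c where "c \<in> S30 n s1 s2" "le3 n b c" "le3 n c a"
    "(\<Sum>i<n. (b i)^3) < (\<Sum>i<n. (c i)^3)" "(\<Sum>i<n. (c i)^3) < (\<Sum>i<n. (a i)^3)"
proof -
  have "(\<Sum>i<n. (a i)^3) - (\<Sum>i<n. (b i)^3) > 0"
    using le3_imp_sum_cubes_less[OF a b le ne] by simp
  then obtain c where c: "c \<in> S30 n s1 s2" "succ3 n c b" "le3 n c a" "(\<Sum>i<n. (b i)^3) < (\<Sum>i<n. (c i)^3)"
    "(\<Sum>i<n. (c i)^3) < (\<Sum>i<n. (b i)^3) + ((\<Sum>i<n. (a i)^3) - (\<Sum>i<n. (b i)^3))"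
    by (rule local_move[OF a b le ne])
  show ?thesis
  proof (rule that[OF c(1) _ c(3,4)])
    show "le3 n b c" by (rule le3_if_succ3[OF S30_imp_S3[OF c(1)] S30_imp_S3[OF b] c(2)])
  qed (use c(5) in simp)
qed

section \<open>The path along a maximal chain\<close>

lemma le3_monotone_path:
  assumes a: "a \<in> S30 n s1 s2" and b: "b \<in> S30 n s1 s2" and le: "le3 n b a" and ne: "a \<noteq> b"
  obtains p :: "real \<Rightarrow> nat \<Rightarrow> real" where "continuous_on {0..1} p" "p 0 = b" "p 1 = a"
    "\<forall>t\<in>{0..1}. p t \<in> S30 n s1 s2"
    "\<forall>t0\<in>{0..1}. \<forall>t1\<in>{0..1}. t0 \<le> t1 \<longrightarrow> le3 n (p t0) (p t1)"
proof -
  define F where "F = (\<lambda>x :: nat \<Rightarrow> real. \<Sum>i<n. (x i)^3)"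
  have contF: "continuous_on A F" for A unfolding F_def by (rule continuous_sum_cubes)
  define Q where "Q = S30 n s1 s2 \<inter> {c. le3 n b c} \<inter> {c. le3 n c a}"
  have Q: "c \<in> S30 n s1 s2" "le3 n b c" "le3 n c a" if "c \<in> Q" for c using that by (auto simp: Q_def)
  have aQ: "a \<in> Q" and bQ: "b \<in> Q" using a b le by (auto simp: Q_def le3_refl)
  have compQ: "compact Q" unfolding Q_def
    by (intro compact_Int_closed compact_S30 closed_le3_lower closed_le3_upper)
  have strict: "F c < F d" if "c \<in> Q" "d \<in> Q" "le3 n c d" "c \<noteq> d" for c d
    using le3_imp_sum_cubes_less[of d n s1 s2 c] Q that unfolding F_def by auto
  interpret pred_on Q "le3 n" .
  have comp_iff: "((le3 n)\<^sup>=\<^sup>=) x y = le3 n x y" for x y using le3_refl by auto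
  obtain C where C: "maxchain C" using Hausdorff by blast
  have CQ: "C \<subseteq> Q" and tot: "\<And>x y. x \<in> C \<Longrightarrow> y \<in> C \<Longrightarrow> le3 n x y \<or> le3 n y x"
    using C unfolding maxchain_def chain_def comp_iff by auto
  have max: "z \<in> C" if z: "z \<in> Q" "\<And>c. c \<in> C \<Longrightarrow> le3 n z c \<or> le3 n c z" for z
  proof (rule ccontr)
    assume "z \<notin> C"
    then have "C \<subset> insert z C" by auto
    moreover have "chain (insert z C)"
      unfolding chain_def comp_iff using CQ tot z le3_refl by blast
    ultimately show False using C unfolding maxchain_def by blast
  qed
  have aC: "a \<in> C" by (rule max[OF aQ]) (use Q CQ in auto)
  have bC: "b \<in> C" by (rule max[OF bQ]) (use Q CQ in auto)
  \<comment> \<open>By maximality the chain consists of all points of \<open>Q\<close> comparable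
    with each of its members, and comparability is a closed condition.\<close>
  have "C = Q \<inter> (\<Inter>c\<in>C. {z. le3 n z c} \<union> {z. le3 n c z})"
    using CQ tot max by blast
  moreover have "closed (\<Inter>c\<in>C. {z. le3 n z c} \<union> {z. le3 n c z})"
    by (intro closed_INT ballI closed_Un closed_le3_lower closed_le3_upper)
  ultimately have compC: "compact C" using compQ compact_Int_closed by metis
  have leF: "le3 n c d" if "c \<in> C" "d \<in> C" "F c \<le> F d" for c d
    using tot[OF that(1,2)] strict[of d c] that CQ le3_refl by fastforce
  have inj: "inj_on F C"
    unfolding inj_on_def using tot strict CQ by (metis less_irrefl subsetD)
  have Fab: "F b < F a" using strict[OF bQ aQ le] ne by blast
  have img: "F ` C = {F b..F a}"
  proof (intro equalityI subsetI)
    fix r assume "r \<in> F ` C"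
    then obtain c where c: "c \<in> C" "r = F c" by blast
    then have "c \<in> Q" using CQ by auto
    then have "F b \<le> F c" "F c \<le> F a"
      using strict[OF bQ, of c] strict[OF _ aQ, of c] Q by fastforce+
    then show "r \<in> {F b..F a}" using c by simp
  next
    fix r assume r: "r \<in> {F b..F a}"
    show "r \<in> F ` C"
    proof (rule ccontr)
      assume no: "r \<notin> F ` C"
      \<comment> \<open>Around a missed height \<open>r\<close>, take the highest chain point below
        and the lowest above. Density puts a point between them that is comparable with the whole
        chain, so it belongs to \<open>C\<close>, contradicting their choice.\<close>
      have "\<exists>c\<in>C \<inter> {c. F c \<le> r}. \<forall>d\<in>C \<inter> {c. F c \<le> r}. F d \<le> F c"
      proof (rule continuous_attains_sup[OF _ _ contF])
        show "compact (C \<inter> {c. F c \<le> r})"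
          by (intro compact_Int_closed compC closed_Collect_le contF continuous_intros)
      qed (use bC r in auto)
      moreover have "\<exists>c\<in>C \<inter> {c. r \<le> F c}. \<forall>d\<in>C \<inter> {c. r \<le> F c}. F c \<le> F d"
      proof (rule continuous_attains_inf[OF _ _ contF])
        show "compact (C \<inter> {c. r \<le> F c})"
          by (intro compact_Int_closed compC closed_Collect_le contF continuous_intros)
      qed (use aC r in auto)
      ultimately obtain c1 c2 where c1: "c1 \<in> C" "F c1 \<le> r" "\<And>d. d \<in> C \<Longrightarrow> F d \<le> r \<Longrightarrow> F d \<le> F c1"
        and c2: "c2 \<in> C" "r \<le> F c2" "\<And>d. d \<in> C \<Longrightarrow> r \<le> F d \<Longrightarrow> F c2 \<le> F d"
        by auto
      have "F c1 \<noteq> r" "F c2 \<noteq> r" using no c1 c2 by auto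
      then have lt: "F c1 < r" "r < F c2" using c1 c2 by auto
      then have ne: "c2 \<noteq> c1" and le: "le3 n c1 c2" using leF[OF c1(1) c2(1)] by auto
      have mem: "c2 \<in> S30 n s1 s2" "c1 \<in> S30 n s1 s2" using Q(1) CQ c1(1) c2(1) by auto
      obtain c where c: "c \<in> S30 n s1 s2" "le3 n c1 c" "le3 n c c2" "F c1 < F c" "F c < F c2"
        unfolding F_def by (rule le3_dense[OF mem le ne])
      have "c \<in> C"
      proof (rule max)
        have "le3 n b c" by (rule le3_trans[OF Q(2) c(2)]) (use c1 CQ in auto)
        moreover have "le3 n c a" by (rule le3_trans[OF c(3) Q(3)]) (use c2 CQ in auto)
        ultimately show "c \<in> Q" using c(1) by (simp add: Q_def)
        fix d assume d: "d \<in> C"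
        show "le3 n c d \<or> le3 n d c"
        proof (cases "F d \<le> r")
          case True
          then have "le3 n d c1" using leF[OF d] c1 d by auto
          then show ?thesis using c le3_trans by blast
        next
          case False
          then have "le3 n c2 d" using leF[OF _ d] c2 d by auto
          then show ?thesis using c le3_trans by blast
        qed
      qed
      then show False using c c1(3)[of c] c2(3)[of c] by linarith
    qed
  qed
  \<comment> \<open>On the compact chain the injective continuous \<open>F\<close> has a continuous
    inverse \<open>g\<close>; \<open>u\<close> rescales \<open>{0..1}\<close> affinely onto the
    range of heights.\<close>
  define g where "g = the_inv_into C F"
  define u where "u = (\<lambda>t. F b + t * (F a - F b))"
  have g: "g (F c) = c" if "c \<in> C" for c unfolding g_def by (rule the_inv_into_f_f[OF inj that])
  have u: "u t \<in> F ` C" if "t \<in> {0..1}" for t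
  proof -
    have "0 \<le> t * (F a - F b)" "t * (F a - F b) \<le> 1 * (F a - F b)"
      using that Fab by (auto intro!: mult_right_mono)
    then show ?thesis unfolding img u_def by simp
  qed
  have gu: "g (u t) \<in> C" "F (g (u t)) = u t" if "t \<in> {0..1}" for t
    using u[OF that] g by auto
  show ?thesis
  proof (rule that[of "\<lambda>t. g (u t)"]; (intro ballI impI)?)
    have "continuous_on (F ` C) g" unfolding g_def by (rule continuous_on_inv_into[OF contF compC inj])
    moreover have "continuous_on {0..1} u" unfolding u_def by (intro continuous_intros)
    ultimately show "continuous_on {0..1} (\<lambda>t. g (u t))"
      by (rule continuous_on_compose2) (use u in auto)
    show "g (u 0) = b" "g (u 1) = a" using g aC bC by (simp_all add: u_def)
    show "g (u t) \<in> S30 n s1 s2" if "t \<in> {0..1}" for t using gu[OF that] CQ Q by auto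
    fix t0 t1 :: real assume t: "t0 \<in> {0..1}" "t1 \<in> {0..1}" "t0 \<le> t1"
    then have "u t0 \<le> u t1" using Fab by (simp add: u_def mult_right_mono)
    then show "le3 n (g (u t0)) (g (u t1))" using gu[OF t(1)] gu[OF t(2)] by (intro leF) auto
  qed
qed

theorem mainTheorem18:
  fixes n :: nat and s1 s2 :: real and a b :: "nat \<Rightarrow> real"
  assumes "n \<ge> 3"
    and "a \<in> S3 n s1 s2" and "b \<in> S3 n s1 s2"
    and "succ3 n a b"
  shows "\<exists>p :: real \<Rightarrow> nat \<Rightarrow> real.
           (\<forall>i<n. continuous_on {0..1} (\<lambda>t. p t i))
         \<and> (\<forall>t\<in>{0..1}. p t \<in> S3 n s1 s2)
         \<and> (\<forall>i<n. p 0 i = b i) \<and> (\<forall>i<n. p 1 i = a i)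
         \<and> (\<forall>t0\<in>{0..1}. \<forall>t1\<in>{0..1}. t0 \<le> t1 \<longrightarrow> succ3 n (p t1) (p t0))"
proof -
  \<comment> \<open>\<open>S3\<close> leaves the coordinates from \<open>n\<close> on arbitrary;
    setting them to 0 gives points of the compact set \<open>S30\<close> with the same sums.\<close>
  define trunc where "trunc = (\<lambda>(x :: nat \<Rightarrow> real) i. if i < n then x i else 0)"
  have S: "trunc x \<in> S30 n s1 s2" if "x \<in> S3 n s1 s2" for x
    using that by (auto simp: S30_def S3_def trunc_def)
  have sums: "(\<Sum>i<n. f (trunc x i)) = (\<Sum>i<n. f (x i))" for f :: "real \<Rightarrow> real" and x
    by (rule sum.cong) (auto simp: trunc_def)
  have "le3 n b a" by (rule le3_if_succ3[OF assms(2,3,4)])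
  then have le: "le3 n (trunc b) (trunc a)" by (simp add: le3_def sums[of "\<lambda>x. (max 0 (_ - x))\<^sup>2"])
  show ?thesis
  proof (cases "trunc a = trunc b")
    case True
    \<comment> \<open>\<open>a\<close> and \<open>b\<close> agree on the relevant coordinates, so
      the constant path at \<open>b\<close> suffices; \<open>le3_monotone_path\<close> covers
      distinct endpoints only.\<close>
    have "a i = b i" if "i < n" for i using fun_cong[OF True, of i] that by (simp add: trunc_def)
    then show ?thesis using assms(3)
      by (intro exI[of _ "\<lambda>_. b"]) (auto simp: succ3_def)
  next
    case False
    obtain p :: "real \<Rightarrow> nat \<Rightarrow> real" where cont: "continuous_on {0..1} p" and ends: "p 0 = trunc b" "p 1 = trunc a"
      and pS: "\<forall>t\<in>{0..1}. p t \<in> S30 n s1 s2"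
      and mono: "\<forall>t0\<in>{0..1}. \<forall>t1\<in>{0..1}. t0 \<le> t1 \<longrightarrow> le3 n (p t0) (p t1)"
      by (rule le3_monotone_path[OF S[OF assms(2)] S[OF assms(3)] le False])
    show ?thesis
    proof (intro exI[of _ p] conjI allI ballI impI)
      show "continuous_on {0..1} (\<lambda>t. p t i)" for i
        by (rule continuous_on_product_then_coordinatewise[OF cont])
      show "p t \<in> S3 n s1 s2" if "t \<in> {0..1}" for t by (rule S30_imp_S3[OF bspec[OF pS that]])
      show "p 0 i = b i" "p 1 i = a i" if "i < n" for i using ends that by (simp_all add: trunc_def)
      show "succ3 n (p t1) (p t0)" if "t0 \<in> {0..1}" "t1 \<in> {0..1}" "t0 \<le> t1" for t0 t1
        by (rule succ3_if_le3) (use pS mono that in auto)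
    qed
  qed
qed

end
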